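(* For every integer $n\ge 2$ let $\epsilon_n=\min_{x_1,\ldots,x_n\in[-1,1]}\Big(-\sum_{i\neq j}\log|x_i-x_j|\Big)$, the minimum being over $n$-tuples of pairwise distinct points of $[-1,1]$ and the sum over ordered pairs $(i,j)$ with $i\ne j$. Then $$\epsilon_n=-n(n-1)\log 2-3(n-1)\log(n-1)-n\log n-4\sum_{j=1}^{n-2}j\log j+\sum_{j=1}^{2n-2}j\log j ,$$ and, as $n\to\infty$, $$\epsilon_n=\log(2)\,n^2-n\log n-2\log(2)\,n-\tfrac14\log n+O(1).$$
   Context: The logarithmic energy of $n$ distinct points $x_1,\dots,x_n$ is $-\sum_{i\ne j}\log|x_i-x_j|$ (each unordered pair is counted twice). Points of $[-1,1]$ attaining the minimum are called Fekete points of $[-1,1]$, so $\epsilon_n$ is the energy of $n$ Fekete points. Empty sums are $0$. *)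

theory Defs
  imports Complex_Main "HOL-Library.Landau_Symbols"
begin

text \<open>
  An \<open>n\<close>-tuple of points is represented by a function on indices, of which only the values at
  \<open>1, \<dots>, n\<close> matter.
\<close>

definition configurations :: "nat \<Rightarrow> (nat \<Rightarrow> real) set" where
  "configurations n = {x. (\<forall>i\<in>{1..n}. x i \<in> {-1..1}) \<and> inj_on x {1..n}}"

definition log_energy :: "nat \<Rightarrow> (nat \<Rightarrow> real) \<Rightarrow> real" where
  "log_energy n x = - (\<Sum>(i, j) \<in> {(i, j). i \<in> {1..n} \<and> j \<in> {1..n} \<and> i \<noteq> j}. ln \<bar>x i - x j\<bar>)"

definition fekete_points :: "nat \<Rightarrow> (nat \<Rightarrow> real) \<Rightarrow> bool" where
  "fekete_points n x \<longleftrightarrow>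
     x \<in> configurations n \<and> (\<forall>y\<in>configurations n. log_energy n x \<le> log_energy n y)"

text \<open>
  On \<^typ>\<open>real\<close>, \<open>LEAST\<close> is the minimum only when one exists, that is, when \<^const>\<open>fekete_points\<close>
  is satisfiable; otherwise the value is unspecified.
\<close>

definition min_energy :: "nat \<Rightarrow> real" where
  "min_energy n = (LEAST e. e \<in> log_energy n ` configurations n)"

end

theory Submission
  imports Defs "HOL-Analysis.Analysis" "HOL-Real_Asymp.Real_Asymp"
begin

text \<open>
  A minimizer exists by compactness. It contains \<open>\<plusminus>1\<close>, since otherwise its largest or smallest point
  could be moved away from all the others, and at an inner point \<open>a\<close> the function
  \<open>t \<mapsto> \<Prod>\<bar>t - b\<bar>\<close>, over the other points \<open>b\<close>, is maximal, so that the second derivative of the nodal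
  polynomial \<open>f\<close> vanishes at \<open>a\<close>. Hence \<open>(X\<^sup>2 - 1) f'' = n (n - 1) f\<close>, an equation with only one monic
  solution of degree \<open>n\<close>, namely \<open>(X\<^sup>2 - 1) q\<close> with \<open>q\<close> the monic Gegenbauer polynomial of degree \<open>n - 2\<close>
  and parameter \<open>3/2\<close>. Existence of minimizers also shows that all roots of \<open>q\<close> are real, so the
  discriminant can be computed in Schur's way: the three-term recurrence evaluates the
  resultant of consecutive polynomials, and \<open>(X\<^sup>2 - 1) q'\<close> is a multiple of the preceding
  polynomial at the roots of \<open>q\<close>. For the asymptotics, the closed form minus the claimed main terms
  has differences of order \<open>n\<^sup>-\<^sup>2\<close>.
\<close>

subsection \<open>Monic Gegenbauer polynomials\<close>

text \<open>The recurrence coefficient of the monic orthogonal polynomials for the weight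
  \<open>1 - x^2\<close> on [-1, 1]: \<open>k (k + 2a - 1) / (4 (k + a) (k + a - 1))\<close> at the
  Gegenbauer parameter \<open>a = 3/2\<close>.\<close>

definition gegen_coeff :: "nat \<Rightarrow> real" where
  "gegen_coeff k = real k * (real k + 2) / ((2 * real k + 1) * (2 * real k + 3))"

fun gegen :: "nat \<Rightarrow> real poly" where
  "gegen 0 = 1"
| "gegen (Suc 0) = [:0, 1:]"
| "gegen (Suc (Suc k)) = [:0, 1:] * gegen (Suc k) - smult (gegen_coeff (Suc k)) (gegen k)"

lemma gegen_monic: "degree (gegen k) \<le> k \<and> coeff (gegen k) k = 1"
proof (induction k rule: gegen.induct)
  case (3 k)
  have "degree ([:0, 1:] * gegen (Suc k)) \<le> Suc (Suc k)"
    using 3 by (auto intro: order.trans[OF degree_pCons_le])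
  moreover have "degree (smult (gegen_coeff (Suc k)) (gegen k)) \<le> Suc (Suc k)"
    using 3 by (auto intro: order.trans[OF degree_smult_le])
  moreover have "coeff (gegen k) (Suc (Suc k)) = 0"
    using 3 by (intro coeff_eq_0) linarith
  ultimately show ?case
    using 3 by (simp add: degree_diff_le)
qed auto

lemma poly_gegen_rec:
  "poly (gegen (Suc (Suc k))) x = x * poly (gegen (Suc k)) x - gegen_coeff (Suc k) * poly (gegen k) x"
  by simp

lemma gegen_coeff_mult:
  "(2 * real k + 1) * (2 * real k + 3) * gegen_coeff k = real k * (real k + 2)"
  by (simp add: gegen_coeff_def)

text \<open>Differentiating the recurrence expresses the derivative at index \<open>k + 2\<close> by
  those at \<open>k + 1\<close> and \<open>k\<close>; after multiplication by \<open>x^2 - 1\<close>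
  the induction hypotheses remove both derivatives, and the relations defining the recurrence
  coefficients do the rest.\<close>

lemma gegen_deriv_up:
  "(x\<^sup>2 - 1) * poly (pderiv (gegen k)) x
     = (2 * real k + 3) * poly (gegen (Suc k)) x - (real k + 3) * x * poly (gegen k) x"
proof (induction k rule: gegen.induct)
  case 1
  show ?case by (simp add: pderiv_1)
next
  case 2
  show ?case by (simp add: gegen_coeff_def pderiv_pCons power2_eq_square field_simps)
next
  case (3 k)
  define c d p q r where "c = gegen_coeff (Suc k)" and "d = gegen_coeff (Suc (Suc k))"
    and "p = poly (gegen k) x" and "q = poly (gegen (Suc k)) x" and "r = poly (gegen (Suc (Suc k))) x"
  have c: "(2 * real k + 3) * (2 * real k + 5) * c = (real k + 1) * (real k + 3)"
    using gegen_coeff_mult[of "Suc k"] by (simp add: c_def algebra_simps)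
  have d: "(2 * real k + 5) * (2 * real k + 7) * d = (real k + 2) * (real k + 4)"
    using gegen_coeff_mult[of "Suc (Suc k)"] by (simp add: d_def algebra_simps)
  have r: "r = x * q - c * p"
    by (simp add: r_def q_def p_def c_def)
  have s: "poly (gegen (Suc (Suc (Suc k)))) x = x * r - d * q"
    by (simp add: r_def q_def p_def d_def)
  have IHp: "(x\<^sup>2 - 1) * poly (pderiv (gegen k)) x = (2 * real k + 3) * q - (real k + 3) * x * p"
    using 3 by (simp add: p_def q_def)
  have IHq: "(x\<^sup>2 - 1) * poly (pderiv (gegen (Suc k))) x = (2 * real k + 5) * r - (real k + 4) * x * q"
    using 3 by (simp add: r_def q_def algebra_simps)
  have "poly (pderiv (gegen (Suc (Suc k)))) x = q + x * poly (pderiv (gegen (Suc k))) x - c * poly (pderiv (gegen k)) x"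
    by (simp add: pderiv_diff pderiv_smult pderiv_mult pderiv_pCons q_def c_def)
  then have "(x\<^sup>2 - 1) * poly (pderiv (gegen (Suc (Suc k)))) x
      = (x\<^sup>2 - 1) * q + x * ((2 * real k + 5) * r - (real k + 4) * x * q)
        - c * ((2 * real k + 3) * q - (real k + 3) * x * p)"
    unfolding IHp[symmetric] IHq[symmetric] by algebra
  also have "\<dots> = (2 * real k + 7) * (x * r - d * q) - (real k + 5) * x * r"
  proof -
    \<comment> \<open>The factor \<open>2 * real k + 5\<close> occurs in both relations
      \<open>c\<close> and \<open>d\<close>; multiplied by it, the identity follows from them by
      polynomial algebra. Being nonzero, it cancels afterwards.\<close>
    have "(2 * real k + 5) * ((x\<^sup>2 - 1) * q + x * ((2 * real k + 5) * r - (real k + 4) * x * q)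
        - c * ((2 * real k + 3) * q - (real k + 3) * x * p))
      = (2 * real k + 5) * ((2 * real k + 7) * (x * r - d * q) - (real k + 5) * x * r)"
      using c d r by algebra
    then show ?thesis
      by simp
  qed
  finally show ?case
    unfolding s by (simp add: r_def algebra_simps)
qed

text \<open>The recurrence eliminates \<open>gegen (k + 2)\<close> from
  \<open>gegen_deriv_up\<close> at \<open>k + 1\<close>. At a root of \<open>gegen (k + 1)\<close>
  only the term with \<open>gegen k\<close> survives.\<close>

lemma gegen_deriv_down:
  "(x\<^sup>2 - 1) * poly (pderiv (gegen (Suc k))) x
     = (real k + 1) * x * poly (gegen (Suc k)) x - (2 * real k + 5) * gegen_coeff (Suc k) * poly (gegen k) x"
  using gegen_deriv_up[of x "Suc k"] unfolding poly_gegen_rec of_nat_Suc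
  by algebra

text \<open>Up to a constant, \<open>gegen k\<close> is the derivative of the Legendre polynomial of
  degree \<open>k + 1\<close>, so the roots of \<open>lobatto k\<close> are the \<open>k + 2\<close>
  Gauss-Lobatto nodes.\<close>

definition lobatto :: "nat \<Rightarrow> real poly" where
  "lobatto k = [:-1, 0, 1:] * gegen k"

text \<open>By \<open>gegen_deriv_up\<close> the first derivative is a combination of
  \<open>gegen (k + 1)\<close> and \<open>X * gegen k\<close>. It is differentiated once more and
  multiplied by \<open>X^2 - 1\<close>, so that both derivative rules apply; this factor is
  cancelled at the end.\<close>

lemma lobatto_ode:
  "pderiv (pderiv (lobatto k)) = smult ((real k + 2) * (real k + 1)) (gegen k)"
proof -
  have "poly (pderiv (lobatto k)) x = poly (smult (2 * real k + 3) (gegen (Suc k)) - smult (real k + 1) ([:0,1:] * gegen k)) x" for x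
    using gegen_deriv_up[of x k]
    unfolding lobatto_def pderiv_mult by (simp add: pderiv_pCons power2_eq_square algebra_simps)
  then have 1: "pderiv (lobatto k) = smult (2 * real k + 3) (gegen (Suc k)) - smult (real k + 1) ([:0,1:] * gegen k)"
    by (intro poly_eq_poly_eq_iff[THEN iffD1] ext)
  have "poly ([:-1, 0, 1:] * pderiv (pderiv (lobatto k))) x
      = poly ([:-1, 0, 1:] * smult ((real k + 2) * (real k + 1)) (gegen k)) x" for x
  proof -
    have "poly ([:-1, 0, 1:] * pderiv (pderiv (lobatto k))) x
      = (2 * real k + 3) * ((x\<^sup>2 - 1) * poly (pderiv (gegen (Suc k))) x)
        - (real k + 1) * ((x\<^sup>2 - 1) * poly (gegen k) x + x * ((x\<^sup>2 - 1) * poly (pderiv (gegen k)) x))"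
      unfolding 1
      by (simp add: pderiv_diff pderiv_smult pderiv_mult pderiv_pCons power2_eq_square algebra_simps)
    also have "\<dots> = ((real k + 2) * (real k + 1)) * ((x\<^sup>2 - 1) * poly (gegen k) x)"
      unfolding gegen_deriv_down gegen_deriv_up[of x k]
      using gegen_coeff_mult[of "Suc k"] unfolding of_nat_Suc by algebra
    finally show ?thesis
      by (simp add: power2_eq_square algebra_simps)
  qed
  then have "[:-1, 0, 1:] * pderiv (pderiv (lobatto k))
      = [:-1, 0, 1:] * smult ((real k + 2) * (real k + 1)) (gegen k)"
    by (intro poly_eq_poly_eq_iff[THEN iffD1] ext)
  then show ?thesis
    by (subst (asm) mult_cancel_left) simp
qed

lemma lobatto_monic: "degree (lobatto k) \<le> k + 2 \<and> coeff (lobatto k) (k + 2) = 1"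
proof
  have "degree (lobatto k) \<le> degree [:-1, 0, 1::real:] + degree (gegen k)"
    unfolding lobatto_def by (rule degree_mult_le)
  then show "degree (lobatto k) \<le> k + 2"
    using gegen_monic[of k] by simp
  have "coeff (gegen k) (Suc (Suc k)) = 0"
    using gegen_monic[of k] by (intro coeff_eq_0) linarith
  then show "coeff (lobatto k) (k + 2) = 1"
    using gegen_monic[of k] by (simp add: lobatto_def)
qed

text \<open>A nonzero difference would solve the same linear equation with a degree
  \<open>d < n\<close>, and comparing leading coefficients would give
  \<open>d (d - 1) = n (n - 1)\<close>.\<close>

lemma ode_solution_unique:
  fixes f g :: "real poly"
  assumes f: "[:-1, 0, 1:] * pderiv (pderiv f) = smult (real n * (real n - 1)) f"
    and g: "[:-1, 0, 1:] * pderiv (pderiv g) = smult (real n * (real n - 1)) g"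
    and "degree f \<le> n" "degree g \<le> n" "coeff f n = 1" "coeff g n = 1" and n: "n \<ge> 2"
  shows "f = g"
proof (rule ccontr)
  define h where "h = f - g"
  assume "f \<noteq> g"
  then have "h \<noteq> 0"
    by (simp add: h_def)
  then have "lead_coeff h \<noteq> 0"
    by simp
  have "degree h \<le> n" "coeff h n = 0"
    using assms by (simp_all add: h_def degree_diff_le)
  then have d: "degree h < n"
    using \<open>lead_coeff h \<noteq> 0\<close> by (metis le_neq_implies_less)
  have ode: "[:-1, 0, 1:] * pderiv (pderiv h) = smult (real n * (real n - 1)) h"
    unfolding h_def pderiv_diff right_diff_distrib f g smult_diff_right ..
  have "coeff ([:-1, 0, 1:] * pderiv (pderiv h)) (degree h) = real (degree h) * (real (degree h) - 1) * lead_coeff h"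
  proof -
    have z: "coeff h (Suc (degree h)) = 0" "coeff h (Suc (Suc (degree h))) = 0"
      by (simp_all add: coeff_eq_0)
    consider "degree h = 0" | "degree h = 1" | j where "degree h = Suc (Suc j)"
      by (metis One_nat_def not0_implies_Suc)
    then show ?thesis
      using z by cases (auto simp: coeff_pderiv algebra_simps)
  qed
  then have "real (degree h) * (real (degree h) - 1) * lead_coeff h = real n * (real n - 1) * lead_coeff h"
    unfolding ode coeff_smult by (rule sym)
  then have "real (degree h) * (real (degree h) - 1) = real n * (real n - 1)"
    using \<open>lead_coeff h \<noteq> 0\<close> by (metis mult_right_cancel)
  moreover have "real (degree h) * (real (degree h) - 1) < real n * (real n - 1)"
  \<comment> \<open>In degree 0 the second factor is -1, so monotonicity of products of nonnegative
    factors does not apply.\<close>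
  proof (cases "degree h = 0")
    case True
    then show ?thesis using n by simp
  next
    case False
    then show ?thesis using d n by (intro mult_strict_mono) auto
  qed
  ultimately show False
    by simp
qed

subsection \<open>Point sets maximizing the product of distances\<close>

text \<open>Each pair counts twice, as in \<open>log_energy\<close>. For the roots of a monic
  polynomial with simple real roots this is the absolute value of its discriminant.\<close>

definition distance_product :: "real set \<Rightarrow> real" where
  "distance_product A = (\<Prod>a\<in>A. \<Prod>b\<in>A - {a}. \<bar>a - b\<bar>)"

lemma distance_product_pos: "finite A \<Longrightarrow> distance_product A > 0"
  unfolding distance_product_def by (intro prod_pos) auto

lemma distance_product_insert:
  assumes "finite A" "t \<notin> A"
  shows "distance_product (insert t A) = distance_product A * (\<Prod>b\<in>A. \<bar>t - b\<bar>)\<^sup>2"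
proof -
  have "(\<Prod>b\<in>insert t A - {a}. \<bar>a - b\<bar>) = \<bar>t - a\<bar> * (\<Prod>b\<in>A - {a}. \<bar>a - b\<bar>)" if "a \<in> A" for a
  proof -
    have "insert t A - {a} = insert t (A - {a})"
      using that assms by auto
    then show ?thesis
      using assms by (simp add: abs_minus_commute)
  qed
  then have "(\<Prod>a\<in>A. \<Prod>b\<in>insert t A - {a}. \<bar>a - b\<bar>) = (\<Prod>a\<in>A. \<bar>t - a\<bar>) * distance_product A"
    unfolding distance_product_def prod.distrib[symmetric] by (intro prod.cong) auto
  moreover have "insert t A - {t} = A"
    using assms by auto
  ultimately show ?thesis
    using assms unfolding distance_product_def by (simp add: power2_eq_square)
qed

section \<open>From energies of tuples to distance products of sets\<close>

lemma prod_pairs_image: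
  assumes "inj_on x {1..n}"
  shows "(\<Prod>i\<in>{1..n}. \<Prod>j\<in>{1..n} - {i}. \<bar>x i - x j\<bar>) = distance_product (x ` {1..n::nat})"
proof -
  have "(\<Prod>b\<in>x ` {1..n} - {x i}. \<bar>x i - b\<bar>) = (\<Prod>j\<in>{1..n} - {i}. \<bar>x i - x j\<bar>)" if "i \<in> {1..n}" for i
  proof -
    have "x ` {1..n} - {x i} = x ` ({1..n} - {i})"
      using inj_on_image_set_diff[OF assms, of "{1..n}" "{i}"] that by auto
    moreover have "inj_on x ({1..n} - {i})"
      using assms by (rule inj_on_subset) auto
    ultimately show ?thesis
      by (simp add: prod.reindex)
  qed
  then show ?thesis
    using assms unfolding distance_product_def by (simp add: prod.reindex)
qed

lemma log_energy_eq:
  assumes "inj_on x {1..n}"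
  shows "log_energy n x = - ln (distance_product (x ` {1..n}))"
proof -
  have pos: "\<bar>x i - x j\<bar> > 0" if "i \<in> {1..n}" "j \<in> {1..n} - {i}" for i j
    using inj_on_eq_iff[OF assms, of i j] that by auto
  have "{(i, j). i \<in> {1..n} \<and> j \<in> {1..n} \<and> i \<noteq> j} = Sigma {1..n} (\<lambda>i. {1..n} - {i})"
    by auto
  then have "log_energy n x = - (\<Sum>i\<in>{1..n}. \<Sum>j\<in>{1..n} - {i}. ln \<bar>x i - x j\<bar>)"
    unfolding log_energy_def by (simp add: sum.Sigma)
  also have "(\<Sum>i\<in>{1..n}. \<Sum>j\<in>{1..n} - {i}. ln \<bar>x i - x j\<bar>)
      = (\<Sum>i\<in>{1..n}. ln (\<Prod>j\<in>{1..n} - {i}. \<bar>x i - x j\<bar>))"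
    using pos by (intro sum.cong refl ln_prod[symmetric]) fastforce+
  also have "\<dots> = ln (\<Prod>i\<in>{1..n}. \<Prod>j\<in>{1..n} - {i}. \<bar>x i - x j\<bar>)"
    using pos by (intro ln_prod[symmetric] prod_pos) fastforce+
  finally show ?thesis
    unfolding prod_pairs_image[OF assms] .
qed

text \<open>Unlike the energy, the product of distances is continuous even where points coincide, so
  it attains its maximum on a compact set. The maximum is positive, hence its points are
  distinct.\<close>

lemma fekete_points_exist: "\<exists>x. fekete_points n x"
proof -
  \<comment> \<open>Coordinates outside \<open>{1..n}\<close> are pinned to 0, which makes
    \<open>K\<close> compact in the space of all functions on the naturals.\<close>
  define K where "K = PiE (UNIV :: nat set) (\<lambda>i. if i \<in> {1..n} then {-1..1} else {0::real})"
  define P where "P = (\<lambda>x :: nat \<Rightarrow> real. \<Prod>i\<in>{1..n}. \<Prod>j\<in>{1..n} - {i}. \<bar>x i - x j\<bar>)"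
  have "compactin (product_topology (\<lambda>i. euclidean) UNIV) K"
    unfolding K_def compactin_PiE by auto
  then have "compact K"
    by (simp add: euclidean_product_topology)
  moreover have "continuous_on K P"
    unfolding P_def
    by (intro continuous_intros continuous_on_subset[OF continuous_on_product_coordinates]) auto
  \<comment> \<open>Any tuple of distinct points in \<open>K\<close> would do; it only witnesses
    that the maximum is positive.\<close>
  moreover define y0 where "y0 = (\<lambda>i. if i \<in> {1..n} then real i / real n else 0)"
  have "-1 \<le> real i / real n" for i
    by (rule order.trans[of _ 0]) auto
  then have "y0 \<in> K"
    by (auto simp: K_def y0_def)
  ultimately obtain x where x: "x \<in> K" "\<And>y. y \<in> K \<Longrightarrow> P y \<le> P x"
    using continuous_attains_sup[of K P] by blast
  have "inj_on y0 {1..n}"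
    by (auto simp: inj_on_def y0_def)
  then have "P y0 > 0"
    unfolding P_def by (subst prod_pairs_image) (auto intro: distance_product_pos)
  then have "P x > 0"
    using x(2)[OF \<open>y0 \<in> K\<close>] by simp
  have inj: "inj_on x {1..n}"
  proof (rule inj_onI, rule ccontr)
    fix i j assume ij: "i \<in> {1..n}" "j \<in> {1..n}" "x i = x j" "i \<noteq> j"
    then have "(\<Prod>j\<in>{1..n} - {i}. \<bar>x i - x j\<bar>) = 0"
      by (intro prod_zero) auto
    then have "P x = 0"
      unfolding P_def using ij(1) by (intro prod_zero) auto
    then show False
      using \<open>P x > 0\<close> by simp
  qed
  have "x i \<in> {-1..1}" if "i \<in> {1..n}" for i
    using x(1) that by (auto simp: K_def PiE_iff Ball_def split: if_splits)
  then have conf: "x \<in> configurations n"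
    using inj by (simp add: configurations_def)
  have "log_energy n x \<le> log_energy n y" if y: "y \<in> configurations n" for y
  proof -
    define z where "z = (\<lambda>i. if i \<in> {1..n} then y i else 0)"
    have "z \<in> K"
      using y by (auto simp: K_def z_def configurations_def)
    have "inj_on y {1..n}"
      using y by (simp add: configurations_def)
    then have "P y = distance_product (y ` {1..n})"
      unfolding P_def by (rule prod_pairs_image)
    moreover have "P z = P y"
      unfolding P_def by (intro prod.cong) (auto simp: z_def)
    moreover have "P x = distance_product (x ` {1..n})"
      unfolding P_def using inj by (rule prod_pairs_image)
    ultimately have "distance_product (y ` {1..n}) \<le> distance_product (x ` {1..n})"
      using x(2)[OF \<open>z \<in> K\<close>] by simp
    then show ?thesis
      unfolding log_energy_eq[OF inj] log_energy_eq[OF \<open>inj_on y {1..n}\<close>]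
      by (simp add: distance_product_pos)
  qed
  then show ?thesis
    using conf unfolding fekete_points_def by blast
qed

definition fekete_set :: "real set \<Rightarrow> bool" where
  "fekete_set A \<longleftrightarrow> finite A \<and> A \<subseteq> {-1..1} \<and>
     (\<forall>B. finite B \<and> B \<subseteq> {-1..1} \<and> card B = card A \<longrightarrow> distance_product B \<le> distance_product A)"

text \<open>Every competing set of \<open>n\<close> points can be enumerated as a configuration, and
  \<open>ln\<close> is increasing.\<close>

lemma fekete_set_image:
  assumes "fekete_points n x"
  shows "fekete_set (x ` {1..n})" "card (x ` {1..n}) = n"
proof -
  have x: "inj_on x {1..n}" "x ` {1..n} \<subseteq> {-1..1}"
    using assms by (auto simp: fekete_points_def configurations_def)
  then show card: "card (x ` {1..n}) = n"
    by (simp add: card_image)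
  have "distance_product B \<le> distance_product (x ` {1..n})"
    if B: "finite B" "B \<subseteq> {-1..1}" "card B = n" for B
  proof -
    obtain y where y: "bij_betw y {1..n} B"
      using ex_bij_betw_nat_finite_1[OF B(1)] B(3) by auto
    then have "y \<in> configurations n" and inj: "inj_on y {1..n}" and img: "y ` {1..n} = B"
      using B(2) by (auto simp: configurations_def bij_betw_def)
    then have "log_energy n x \<le> log_energy n y"
      using assms by (simp add: fekete_points_def)
    then show ?thesis
      using B(1) unfolding log_energy_eq[OF x(1)] log_energy_eq[OF inj] img
      by (simp add: distance_product_pos)
  qed
  then show "fekete_set (x ` {1..n})"
    using x card by (auto simp: fekete_set_def)
qed

lemma fekete_setD:
  assumes "fekete_set A" "finite B" "B \<subseteq> {-1..1}" "card B = card A"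
  shows "distance_product B \<le> distance_product A"
  using assms by (simp add: fekete_set_def)

text \<open>Moving \<open>a\<close> to \<open>t\<close> changes only the distances to the remaining
  points, whose product enters \<open>distance_product\<close> squared. If \<open>t\<close> is one
  of those points, the left-hand side is 0.\<close>

lemma fekete_set_replace:
  assumes "fekete_set A" "a \<in> A" "t \<in> {-1..1}"
  shows "(\<Prod>b\<in>A - {a}. \<bar>t - b\<bar>) \<le> (\<Prod>b\<in>A - {a}. \<bar>a - b\<bar>)"
proof (cases "t \<in> A - {a}")
  case True
  then have "(\<Prod>b\<in>A - {a}. \<bar>t - b\<bar>) = 0"
    using assms by (intro prod_zero) (auto simp: fekete_set_def)
  then show ?thesis
    by (simp add: prod_nonneg)
next
  case False
  have fin: "finite A" "finite (A - {a})"
    using assms by (auto simp: fekete_set_def)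
  have card: "card (insert t (A - {a})) = card A"
    using False fin assms(2) by (metis card.remove card_insert_disjoint)
  have sub: "insert t (A - {a}) \<subseteq> {-1..1}"
    using assms by (auto simp: fekete_set_def)
  have "distance_product (insert t (A - {a})) \<le> distance_product A"
    using fin by (intro fekete_setD[OF assms(1) _ sub card]) simp
  also have "distance_product A = distance_product (A - {a}) * (\<Prod>b\<in>A - {a}. \<bar>a - b\<bar>)\<^sup>2"
    using distance_product_insert[OF fin(2), of a] assms(2) by (simp add: insert_absorb)
  finally have "(\<Prod>b\<in>A - {a}. \<bar>t - b\<bar>)\<^sup>2 \<le> (\<Prod>b\<in>A - {a}. \<bar>a - b\<bar>)\<^sup>2"
    using distance_product_pos[OF fin(2)] unfolding distance_product_insert[OF fin(2) False] by simp
  then show ?thesis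
    by (rule power2_le_imp_le) (simp add: prod_nonneg)
qed

text \<open>Otherwise moving \<open>a\<close> to \<open>t\<close> would increase every distance to
  the other points. At least one other point exists, so the product would increase strictly.\<close>

lemma fekete_set_no_farther_point:
  assumes A: "fekete_set A" and card: "card A \<ge> 2" and a: "a \<in> A" and t: "t \<in> {-1..1}"
  shows "\<exists>b\<in>A. \<bar>t - b\<bar> \<le> \<bar>a - b\<bar>"
proof (rule ccontr)
  assume "\<not> ?thesis"
  then have lt: "\<bar>a - b\<bar> < \<bar>t - b\<bar>" if "b \<in> A" for b
    using that by auto
  have "card (A - {a}) > 0"
    using card a by (simp add: card_Diff_singleton)
  then obtain c where fin: "finite (A - {a})" and c: "c \<in> A - {a}"
    unfolding card_gt_0_iff by blast
  have "(\<Prod>b\<in>A - {a}. \<bar>a - b\<bar>) < (\<Prod>b\<in>A - {a}. \<bar>t - b\<bar>)"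
  proof (rule prod_mono_strict[OF c lt fin])
    fix b assume b: "b \<in> A - {a}"
    show "0 \<le> \<bar>a - b\<bar> \<and> \<bar>a - b\<bar> \<le> \<bar>t - b\<bar>" "0 < \<bar>t - b\<bar>"
      using lt[of b] b by auto
  qed (use c in blast)
  then show False
    using fekete_set_replace[OF A a t] by simp
qed

text \<open>If the largest point were below 1, then 1 would be farther from every point of the set
  than it is; symmetrically for the smallest point and -1.\<close>

lemma fekete_set_endpoints:
  assumes A: "fekete_set A" and card: "card A \<ge> 2"
  shows "1 \<in> A" "-1 \<in> A"
proof -
  have fin: "finite A" and sub: "A \<subseteq> {-1..1}" and ne: "A \<noteq> {}"
    using assms by (auto simp: fekete_set_def)
  have Max: "Max A \<in> A" "b \<in> A \<Longrightarrow> b \<le> Max A" and Min: "Min A \<in> A" "b \<in> A \<Longrightarrow> Min A \<le> b" for b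
    using fin ne by auto
  obtain b where "b \<in> A" "\<bar>1 - b\<bar> \<le> \<bar>Max A - b\<bar>"
    using fekete_set_no_farther_point[OF A card Max(1), of 1] by auto
  moreover have "Max A \<le> 1"
    using Max(1) sub by auto
  ultimately have "Max A = 1"
    using Max(2)[of b] by linarith
  then show "1 \<in> A"
    using Max(1) by simp
  obtain b where "b \<in> A" "\<bar>-1 - b\<bar> \<le> \<bar>Min A - b\<bar>"
    using fekete_set_no_farther_point[OF A card Min(1), of "-1"] by auto
  moreover have "-1 \<le> Min A"
    using Min(1) sub by auto
  ultimately have "Min A = -1"
    using Min(2)[of b] by linarith
  then show "-1 \<in> A"
    using Min(1) by simp
qed

section \<open>Nodal polynomials and the differential equation of a maximizer\<close>

definition nodal :: "real set \<Rightarrow> real poly" where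
  "nodal A = (\<Prod>a\<in>A. [:-a, 1:])"

lemma poly_nodal: "poly (nodal A) x = (\<Prod>a\<in>A. x - a)"
  by (simp add: nodal_def poly_prod)

lemma poly_nodal_eq_0_iff: "finite A \<Longrightarrow> poly (nodal A) x = 0 \<longleftrightarrow> x \<in> A"
  by (auto simp: poly_nodal)

lemma degree_nodal: "degree (nodal A) = card A"
  unfolding nodal_def by (subst degree_prod_sum_eq) auto

lemma coeff_nodal: "coeff (nodal A) (card A) = 1"
  using lead_coeff_prod[of "\<lambda>a. [:-a, 1:]" A] degree_nodal[of A] by (simp add: nodal_def)

lemma nodal_remove: "finite A \<Longrightarrow> a \<in> A \<Longrightarrow> nodal A = [:-a, 1:] * nodal (A - {a})"
  unfolding nodal_def by (simp add: prod.remove)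

lemma poly_pderiv_nodal:
  assumes "finite A" "a \<in> A"
  shows "poly (pderiv (nodal A)) a = (\<Prod>b\<in>A - {a}. a - b)"
  unfolding nodal_remove[OF assms] pderiv_mult by (simp add: pderiv_pCons poly_nodal)

text \<open>With \<open>f = (X - a) g\<close> for the nodal polynomial \<open>f\<close>, the second
  derivative of \<open>f\<close> at \<open>a\<close> is twice \<open>g'(a)\<close>. The square of
  \<open>g\<close>, taken in place of its absolute value to stay differentiable, has a local maximum
  at \<open>a\<close>, and \<open>g(a)\<close> is nonzero.\<close>

lemma fekete_set_second_deriv:
  assumes A: "fekete_set A" and a: "a \<in> A" "-1 < a" "a < 1"
  shows "poly (pderiv (pderiv (nodal A))) a = 0"
proof -
  have fin: "finite A"
    using A by (simp add: fekete_set_def)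
  define g where "g = nodal (A - {a})"
  have "poly g a \<noteq> 0"
    using fin by (simp add: g_def poly_nodal_eq_0_iff)
  have "poly (pderiv (g\<^sup>2)) a = 0"
  proof (rule DERIV_local_max)
    show "DERIV (poly (g\<^sup>2)) a :> poly (pderiv (g\<^sup>2)) a"
      by (rule poly_DERIV)
    \<comment> \<open>Within this radius of \<open>a\<close> all points stay in [-1, 1], where
      \<open>a\<close> is a maximizer.\<close>
    show "0 < min (1 - a) (a + 1)"
      using a by simp
    show "\<forall>y. \<bar>a - y\<bar> < min (1 - a) (a + 1) \<longrightarrow> poly (g\<^sup>2) y \<le> poly (g\<^sup>2) a"
    proof (intro allI impI)
      fix y assume "\<bar>a - y\<bar> < min (1 - a) (a + 1)"
      then have "y \<in> {-1..1}"
        by (auto simp: abs_if split: if_splits)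
      then have "\<bar>poly g y\<bar> \<le> \<bar>poly g a\<bar>"
        using fekete_set_replace[OF A a(1)] by (simp add: g_def poly_nodal abs_prod)
      then show "poly (g\<^sup>2) y \<le> poly (g\<^sup>2) a"
        by (simp add: abs_le_square_iff)
    qed
  qed
  then have "poly (pderiv g) a = 0"
    using \<open>poly g a \<noteq> 0\<close> by (simp add: power2_eq_square pderiv_mult)
  moreover have "poly (pderiv (pderiv (nodal A))) a = 2 * poly (pderiv g) a"
    unfolding nodal_remove[OF fin a(1)] g_def[symmetric] pderiv_mult pderiv_add
    by (simp add: pderiv_pCons pderiv_mult)
  ultimately show ?thesis
    by simp
qed

text \<open>Both sides have degree at most \<open>card A\<close> and the same coefficient there, and
  both vanish on \<open>A\<close>: at 1 and -1 because of the factor \<open>X^2 - 1\<close>,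
  elsewhere because of the second derivative.\<close>

lemma fekete_set_ode:
  assumes A: "fekete_set A" and card: "card A \<ge> 2"
  shows "[:-1, 0, 1:] * pderiv (pderiv (nodal A)) = smult (real (card A) * (real (card A) - 1)) (nodal A)"
proof (rule poly_eqI_degree_lead_coeff)
  have fin: "finite A"
    using A by (simp add: fekete_set_def)
  obtain k where k: "card A = Suc (Suc k)"
    using le_Suc_ex[OF card] by auto
  have "coeff (nodal A) (Suc (Suc (Suc k))) = 0" "coeff (nodal A) (Suc (Suc (Suc (Suc k)))) = 0"
    using k by (simp_all add: coeff_eq_0 degree_nodal)
  then show "coeff ([:-1, 0, 1:] * pderiv (pderiv (nodal A))) (card A)
      = coeff (smult (real (card A) * (real (card A) - 1)) (nodal A)) (card A)"
    using coeff_nodal[of A] by (simp add: k coeff_pderiv)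
  show "card A \<le> card A" ..
  have "degree ([:-1, 0, 1:] * pderiv (pderiv (nodal A))) \<le> degree [:-1, 0, 1::real:] + degree (pderiv (pderiv (nodal A)))"
    by (rule degree_mult_le)
  then show "degree ([:-1, 0, 1:] * pderiv (pderiv (nodal A))) \<le> card A"
    using k by (simp add: degree_pderiv degree_nodal)
  show "degree (smult (real (card A) * (real (card A) - 1)) (nodal A)) \<le> card A"
    by (rule order.trans[OF degree_smult_le]) (simp add: degree_nodal)
  fix a assume a: "a \<in> A"
  then have z: "poly (nodal A) a = 0"
    using fin by (simp add: poly_nodal_eq_0_iff)
  consider "a = 1" | "a = -1" | "-1 < a" "a < 1"
    using a A by (fastforce simp: fekete_set_def)
  then show "poly ([:-1, 0, 1:] * pderiv (pderiv (nodal A))) a = poly (smult (real (card A) * (real (card A) - 1)) (nodal A)) a"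
  proof cases
    case 3
    then show ?thesis
      using z fekete_set_second_deriv[OF A a] by simp
  qed (use z in simp_all)
qed

subsection \<open>The closed form and its asymptotics\<close>

text \<open>The differences are summable by comparison, so the telescoping sums converge, and a
  convergent sequence is bounded.\<close>

lemma bigo_one_if_summable_differences:
  fixes f :: "nat \<Rightarrow> real"
  assumes "(\<lambda>n. f (Suc n) - f n) \<in> O(\<lambda>n. 1 / real n ^ 2)"
  shows "f \<in> O(\<lambda>_. 1)"
proof -
  have "summable (\<lambda>n. norm (1 / real n ^ 2))"
    using inverse_power_summable[of 2, where 'a = real] by (simp add: field_simps)
  then have "summable (\<lambda>n. f (Suc n) - f n)"
    using assms by (rule summable_comparison_test_bigo)
  then have "convergent (\<lambda>n. \<Sum>k<n. f (Suc k) - f k)"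
    by (simp add: summable_iff_convergent)
  then have "convergent (\<lambda>n. f n - f 0)"
    by (simp add: sum_lessThan_telescope)
  then have "convergent f"
    by (simp add: convergent_diff_const_right_iff)
  then obtain L where "f \<longlonglongrightarrow> L"
    by (auto simp: convergent_def)
  then show ?thesis
    by (intro bigoI_tendsto[where c = L]) auto
qed

definition fekete_energy :: "nat \<Rightarrow> real" where
  "fekete_energy n =
     - real n * (real n - 1) * ln 2 - 3 * (real n - 1) * ln (real n - 1) - real n * ln (real n)
     - 4 * (\<Sum>j=1..n-2. real j * ln (real j)) + (\<Sum>j=1..2*n-2. real j * ln (real j))"

text \<open>The terms with \<open>ln 2\<close> and \<open>ln n\<close> cancel. This difference
  serves both the asymptotics and the inductive proof of the closed form.\<close>

lemma fekete_energy_Suc: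
  assumes "n \<ge> 2"
  shows "fekete_energy (Suc n) - fekete_energy n = (2 * real n - 1) * ln (2 * real n - 1)
    - (real n + 1) * ln (real n + 1) - (real n - 1) * ln (real n - 1)"
proof -
  obtain k where n: "n = Suc (Suc k)"
    using assms by (metis One_nat_def Suc_1 Suc_le_D Suc_le_mono)
  have "2 * Suc n - 2 = Suc (Suc (2 * n - 2))" "Suc n - 2 = Suc (n - 2)"
    using assms by auto
  moreover have "ln (2 * real n) = ln 2 + ln (real n)"
    using assms by (simp add: ln_mult)
  ultimately show ?thesis
    using n by (simp add: fekete_energy_def algebra_simps)
qed

lemma fekete_energy_asymp:
  "(\<lambda>n. fekete_energy n - (ln 2 * (real n)^2 - real n * ln (real n) - 2 * ln 2 * real n - 1/4 * ln (real n)))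
    \<in> O(\<lambda>_. 1)" (is "?f \<in> _")
proof (rule bigo_one_if_summable_differences)
  \<comment> \<open>With \<open>g(x) = x ln x\<close> the terms before the quarter logarithms are
    \<open>2 g(n - 1/2) - g(n - 1) - g(n)\<close>, a negated second difference, approximately
    \<open>-1/(4n)\<close>. The quarter logarithms cancel this order.\<close>
  have *: "(\<lambda>n::nat. (2 * real n - 1) * ln (2 * real n - 1) - (real n - 1) * ln (real n - 1) - real n * ln (real n)
     - (2 * real n - 1) * ln 2 + 1/4 * ln (real n + 1) - 1/4 * ln (real n)) \<in> O(\<lambda>n. 1 / real n ^ 2)"
    by real_asymp
  have "eventually (\<lambda>n. ?f (Suc n) - ?f n = (2 * real n - 1) * ln (2 * real n - 1) - (real n - 1) * ln (real n - 1) - real n * ln (real n)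
     - (2 * real n - 1) * ln 2 + 1/4 * ln (real n + 1) - 1/4 * ln (real n)) at_top"
    using eventually_ge_at_top[of 2]
  proof eventually_elim
    case (elim n)
    then show ?case
      using fekete_energy_Suc[OF elim] by (simp add: algebra_simps power2_eq_square)
  qed
  from landau_o.big.in_cong[OF this] * show "(\<lambda>n. ?f (Suc n) - ?f n) \<in> O(\<lambda>n. 1 / real n ^ 2)"
    by blast
qed

subsection \<open>Roots, resultants and the minimal energy\<close>

lemma fekete_set_nodal:
  assumes "fekete_set A" "card A = k + 2"
  shows "nodal A = lobatto k"
proof (rule ode_solution_unique)
  show "[:-1, 0, 1:] * pderiv (pderiv (nodal A)) = smult (real (k + 2) * (real (k + 2) - 1)) (nodal A)"
    using fekete_set_ode[OF assms(1)] assms(2) by simp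
  show "[:-1, 0, 1:] * pderiv (pderiv (lobatto k)) = smult (real (k + 2) * (real (k + 2) - 1)) (lobatto k)"
    unfolding lobatto_ode unfolding lobatto_def mult_smult_right by (simp add: algebra_simps)
  show "coeff (nodal A) (k + 2) = 1"
    using coeff_nodal[of A] assms(2) by simp
  show "degree (nodal A) \<le> k + 2"
    using degree_nodal[of A] assms(2) by simp
qed (use lobatto_monic[of k] in auto)

definition gegen_roots :: "nat \<Rightarrow> real set" where
  "gegen_roots k = {x. poly (gegen k) x = 0}"

lemma fekete_set_gegen:
  assumes A: "fekete_set A" and card: "card A = k + 2"
  shows "gegen_roots k = A - {1, -1}" "gegen k = nodal (gegen_roots k)"
proof -
  have fin: "finite A"
    using A by (simp add: fekete_set_def)
  have mem: "1 \<in> A" "-1 \<in> A - {1}"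
    using fekete_set_endpoints[OF A] card by auto
  have "nodal A = [:-1, 1:] * ([:1, 1:] * nodal (A - {1} - {-1}))"
    using nodal_remove[OF fin mem(1)] nodal_remove[OF _ mem(2)] fin by simp
  also have "A - {1} - {-1} = A - {1, -1}"
    by auto
  also have "[:-1, 1:] * ([:1, 1:] * nodal (A - {1, -1})) = [:-1, 0, 1:] * nodal (A - {1, -1})"
    unfolding mult.assoc[symmetric] by simp
  finally have "[:-1, 0, 1:] * gegen k = [:-1, 0, 1:] * nodal (A - {1, -1})"
    using fekete_set_nodal[OF assms] unfolding lobatto_def by simp
  then have gegen: "gegen k = nodal (A - {1, -1})"
    by (subst (asm) mult_cancel_left) simp
  show roots: "gegen_roots k = A - {1, -1}"
    unfolding gegen_roots_def gegen using fin by (auto simp: poly_nodal_eq_0_iff)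
  show "gegen k = nodal (gegen_roots k)"
    unfolding roots by (rule gegen)
qed

text \<open>A maximizing set of \<open>k + 2\<close> points exists; without its endpoints it
  consists of \<open>k\<close> distinct real roots of \<open>gegen k\<close>, which are therefore
  all of them.\<close>

lemma
  shows finite_gegen_roots [simp]: "finite (gegen_roots k)"
    and card_gegen_roots: "card (gegen_roots k) = k"
    and gegen_eq_nodal: "gegen k = nodal (gegen_roots k)"
    and gegen_roots_endpoints: "1 \<notin> gegen_roots k" "-1 \<notin> gegen_roots k"
proof -
  obtain A where A: "fekete_set A" "card A = k + 2"
    using fekete_points_exist[of "k + 2"] fekete_set_image by blast
  then have "finite A" "{1, -1} \<subseteq> A"
    using fekete_set_endpoints[OF A(1)] by (auto simp: fekete_set_def)
  then show "finite (gegen_roots k)" "card (gegen_roots k) = k" "1 \<notin> gegen_roots k" "-1 \<notin> gegen_roots k"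
    using A(2) unfolding fekete_set_gegen(1)[OF A] by (simp_all add: card_Diff_subset)
  show "gegen k = nodal (gegen_roots k)"
    by (rule fekete_set_gegen[OF A])
qed

section \<open>Resultants and the discriminant\<close>

lemma abs_poly_gegen: "\<bar>poly (gegen k) x\<bar> = (\<Prod>b\<in>gegen_roots k. \<bar>x - b\<bar>)"
  by (subst gegen_eq_nodal) (simp add: poly_nodal abs_prod)

text \<open>For \<open>k = 0\<close> the product is empty, so the truncated \<open>k - 1\<close> does no harm.\<close>

definition gegen_res :: "nat \<Rightarrow> real" where
  "gegen_res k = (\<Prod>b\<in>gegen_roots k. \<bar>poly (gegen (k - 1)) b\<bar>)"

lemma gegen_res_0: "gegen_res 0 = 1"
  using card_gegen_roots[of 0] by (simp add: gegen_res_def)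

lemma gegen_coeff_nonneg: "gegen_coeff k \<ge> 0"
  by (simp add: gegen_coeff_def)

text \<open>\<open>gegen_res\<close> is the absolute resultant of consecutive polynomials, hence may
  be evaluated at the roots of either one. At a root of \<open>gegen k\<close> the recurrence
  reduces \<open>gegen (k + 1)\<close> to \<open>- gegen_coeff k * gegen (k - 1)\<close>.\<close>

lemma gegen_res_Suc: "gegen_res (Suc k) = gegen_coeff k ^ k * gegen_res k"
proof -
  have "gegen_res (Suc k) = (\<Prod>b\<in>gegen_roots (Suc k). \<Prod>c\<in>gegen_roots k. \<bar>b - c\<bar>)"
    by (simp add: gegen_res_def abs_poly_gegen)
  also have "\<dots> = (\<Prod>c\<in>gegen_roots k. \<bar>poly (gegen (Suc k)) c\<bar>)"
    by (subst prod.swap) (simp add: abs_poly_gegen abs_minus_commute)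
  also have "\<dots> = (\<Prod>c\<in>gegen_roots k. gegen_coeff k * \<bar>poly (gegen (k - 1)) c\<bar>)"
  proof (intro prod.cong refl)
    fix c assume c: "c \<in> gegen_roots k"
    \<comment> \<open>The constant \<open>gegen 0\<close> has no roots, so \<open>k - 1\<close> is
      not truncated here.\<close>
    then obtain j where "k = Suc j"
      by (cases k) (auto simp: gegen_roots_def)
    then show "\<bar>poly (gegen (Suc k)) c\<bar> = gegen_coeff k * \<bar>poly (gegen (k - 1)) c\<bar>"
      using c gegen_coeff_nonneg[of k] by (simp add: gegen_roots_def abs_mult)
  qed
  finally show ?thesis
    by (simp add: prod.distrib card_gegen_roots gegen_res_def)
qed

text \<open>At 1 and -1 the derivative term of \<open>gegen_deriv_up\<close> vanishes.\<close>

lemma abs_gegen_endpoint_Suc: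
  assumes "x\<^sup>2 = (1::real)"
  shows "(2 * real k + 3) * \<bar>poly (gegen (Suc k)) x\<bar> = (real k + 3) * \<bar>poly (gegen k) x\<bar>"
proof -
  have "(2 * real k + 3) * poly (gegen (Suc k)) x = (real k + 3) * (x * poly (gegen k) x)"
    using gegen_deriv_up[of x k] assms by simp
  then have "\<bar>(2 * real k + 3) * poly (gegen (Suc k)) x\<bar> = \<bar>(real k + 3) * (x * poly (gegen k) x)\<bar>"
    by simp
  moreover have "\<bar>x\<bar> = 1"
    using assms by (auto simp: power2_eq_1_iff)
  ultimately show ?thesis
    by (simp add: abs_mult)
qed

lemma abs_gegen_minus_one: "\<bar>poly (gegen k) (-1)\<bar> = \<bar>poly (gegen k) 1\<bar>"
proof (induction k)
  case (Suc k)
  have "(2 * real k + 3) * \<bar>poly (gegen (Suc k)) (-1)\<bar> = (2 * real k + 3) * \<bar>poly (gegen (Suc k)) 1\<bar>"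
    using abs_gegen_endpoint_Suc[of "-1" k] abs_gegen_endpoint_Suc[of 1 k] Suc by simp
  then show ?case
    by simp
qed simp

lemma gegen_deriv_at_root:
  assumes "b \<in> gegen_roots k"
  shows "\<bar>b\<^sup>2 - 1\<bar> * \<bar>poly (pderiv (gegen k)) b\<bar> = (2 * real k + 3) * gegen_coeff k * \<bar>poly (gegen (k - 1)) b\<bar>"
proof -
  obtain j where j: "k = Suc j"
    using assms by (cases k) (auto simp: gegen_roots_def)
  then have "(b\<^sup>2 - 1) * poly (pderiv (gegen k)) b = - ((2 * real k + 3) * gegen_coeff k * poly (gegen (k - 1)) b)"
    using gegen_deriv_down[of b j] assms by (simp add: gegen_roots_def)
  then have "\<bar>(b\<^sup>2 - 1) * poly (pderiv (gegen k)) b\<bar> = \<bar>(2 * real k + 3) * gegen_coeff k * poly (gegen (k - 1)) b\<bar>"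
    by simp
  then show ?thesis
    using gegen_coeff_nonneg[of k] by (simp add: abs_mult)
qed

text \<open>The discriminant is the product of the derivatives at the roots. The product of all
  \<open>\<bar>b^2 - 1\<bar>\<close> is the product of the endpoint values, and with these factors
  \<open>gegen_deriv_at_root\<close> turns the derivatives into values of the preceding polynomial,
  that is, into the resultant.\<close>

lemma distance_product_gegen_roots:
  "\<bar>poly (gegen k) 1\<bar>\<^sup>2 * distance_product (gegen_roots k) = ((2 * real k + 3) * gegen_coeff k) ^ k * gegen_res k"
proof -
  have "\<bar>poly (gegen k) 1\<bar>\<^sup>2 = \<bar>poly (gegen k) 1\<bar> * \<bar>poly (gegen k) (-1)\<bar>"
    by (simp add: abs_gegen_minus_one power2_eq_square)
  also have "\<dots> = (\<Prod>b\<in>gegen_roots k. \<bar>1 - b\<bar> * \<bar>-1 - b\<bar>)"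
    by (simp only: abs_poly_gegen prod.distrib)
  also have "\<dots> = (\<Prod>b\<in>gegen_roots k. \<bar>b\<^sup>2 - 1\<bar>)"
    by (intro prod.cong) (simp_all add: power2_eq_square algebra_simps flip: abs_mult)
  finally have 1: "\<bar>poly (gegen k) 1\<bar>\<^sup>2 = (\<Prod>b\<in>gegen_roots k. \<bar>b\<^sup>2 - 1\<bar>)" .
  have 2: "distance_product (gegen_roots k) = (\<Prod>b\<in>gegen_roots k. \<bar>poly (pderiv (gegen k)) b\<bar>)"
    unfolding distance_product_def
    by (intro prod.cong refl, subst gegen_eq_nodal) (simp add: poly_pderiv_nodal abs_prod)
  have "\<bar>poly (gegen k) 1\<bar>\<^sup>2 * distance_product (gegen_roots k)
      = (\<Prod>b\<in>gegen_roots k. (2 * real k + 3) * gegen_coeff k * \<bar>poly (gegen (k - 1)) b\<bar>)"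
    unfolding 1 2 prod.distrib[symmetric] by (intro prod.cong refl gegen_deriv_at_root)
  then show ?thesis
    by (simp only: prod.distrib prod_constant card_gegen_roots gegen_res_def power_mult_distrib)
qed

lemma distance_product_fekete_set:
  assumes A: "fekete_set A" and card: "card A = k + 2"
  shows "distance_product A = 4 * \<bar>poly (gegen k) 1\<bar>\<^sup>2 * ((2 * real k + 3) * gegen_coeff k) ^ k * gegen_res k"
proof -
  have "A = insert 1 (insert (-1) (gegen_roots k))"
    using fekete_set_endpoints[OF A] card unfolding fekete_set_gegen(1)[OF assms] by auto
  \<comment> \<open>The points -1 and 1 are adjoined in this order; the extra 2 in the last factor
    is their distance from each other.\<close>
  then have "distance_product A = distance_product (gegen_roots k) * \<bar>poly (gegen k) 1\<bar>\<^sup>2 * (2 * \<bar>poly (gegen k) 1\<bar>)\<^sup>2"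
    using gegen_roots_endpoints[of k]
    by (simp add: distance_product_insert abs_gegen_minus_one flip: abs_poly_gegen)
  also have "\<dots> = 4 * \<bar>poly (gegen k) 1\<bar>\<^sup>2 * (\<bar>poly (gegen k) 1\<bar>\<^sup>2 * distance_product (gegen_roots k))"
    by (simp add: power2_eq_square)
  finally show ?thesis
    unfolding distance_product_gegen_roots by (simp only: mult.assoc)
qed

lemma ln_fekete_product:
  "- ln (4 * \<bar>poly (gegen k) 1\<bar>\<^sup>2 * ((2 * real k + 3) * gegen_coeff k) ^ k * gegen_res k) = fekete_energy (k + 2)"
proof -
  define p where "p k = \<bar>poly (gegen k) 1\<bar>" for k
  have p: "p k > 0" for k
    using gegen_roots_endpoints[of k] by (simp add: p_def gegen_roots_def)
  have c: "gegen_coeff k > 0" if "k > 0" for k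
    using that by (simp add: gegen_coeff_def)
  have r: "gegen_res k > 0" for k
  proof (induction k)
    case (Suc k)
    then show ?case
      using c[of k] by (cases "k = 0") (simp_all add: gegen_res_Suc)
  qed (simp add: gegen_res_0)
  \<comment> \<open>Since \<open>gegen_coeff 0 = 0\<close>, the third term at \<open>k = 0\<close>
    is 0 times \<open>ln 0\<close>, which matches \<open>0 ^ 0 = 1\<close>. This is why
    \<open>k = 0\<close> is treated separately below.\<close>
  define e where "e k = ln 4 + 2 * ln (p k) + real k * ln ((2 * real k + 3) * gegen_coeff k) + ln (gegen_res k)" for k
  have "ln (4 * (p k)\<^sup>2 * ((2 * real k + 3) * gegen_coeff k) ^ k * gegen_res k) = e k"
  proof (cases "k = 0")
    case False
    define b where "b = (2 * real k + 3) * gegen_coeff k"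
    have "b > 0"
      using c[of k] False by (simp add: b_def)
    then show ?thesis
      using p[of k] r[of k] unfolding e_def b_def[symmetric] by (simp add: ln_mult ln_realpow)
  qed (use p[of 0] in \<open>simp add: e_def ln_mult ln_realpow gegen_res_0\<close>)
  moreover have "- e k = fekete_energy (k + 2)"
  proof (induction k)
    case 0
    show ?case
      using ln_realpow[of 2 2]
      by (simp add: e_def p_def gegen_res_0 fekete_energy_def numeral_2_eq_2)
  next
    case (Suc k)
    have "(2 * real (Suc k) + 3) * gegen_coeff (Suc k) = (real k + 1) * (real k + 3) / (2 * real k + 3)"
      by (intro eq_divide_imp) (use gegen_coeff_mult[of "Suc k"] in \<open>simp_all add: algebra_simps\<close>)
    then have 1: "ln ((2 * real (Suc k) + 3) * gegen_coeff (Suc k)) = ln (real k + 1) + ln (real k + 3) - ln (2 * real k + 3)"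
      by (simp add: ln_mult ln_div)
    have "p (Suc k) = (real k + 3) / (2 * real k + 3) * p k"
      using abs_gegen_endpoint_Suc[of 1 k] by (simp add: p_def field_simps)
    then have 2: "ln (p (Suc k)) = ln (real k + 3) - ln (2 * real k + 3) + ln (p k)"
      using p[of k] by (simp add: ln_mult ln_div)
    have 3: "ln (gegen_res (Suc k)) = real k * ln (gegen_coeff k) + ln (gegen_res k)"
      using r[of k] c[of k] by (cases "k = 0") (simp_all add: gegen_res_Suc ln_mult ln_realpow)
    have 4: "real k * ln ((2 * real k + 3) * gegen_coeff k) = real k * ln (2 * real k + 3) + real k * ln (gegen_coeff k)"
    proof (cases "k = 0")
      case False
      then have "ln ((2 * real k + 3) * gegen_coeff k) = ln (2 * real k + 3) + ln (gegen_coeff k)"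
        using c[of k] by (intro ln_mult_pos) auto
      then show ?thesis
        by (simp only: distrib_left)
    qed simp
    \<comment> \<open>The terms \<open>real k * ln (gegen_coeff k)\<close> from \<open>3\<close> and
      \<open>4\<close> cancel, which leaves exactly the negated increment of
      \<open>fekete_energy\<close>.\<close>
    have "e (Suc k) - e k = (real k + 3) * ln (real k + 3) + (real k + 1) * ln (real k + 1) - (2 * real k + 3) * ln (2 * real k + 3)"
      unfolding e_def 1 2 3 4 by (simp add: algebra_simps)
    moreover have "fekete_energy (Suc k + 2) - fekete_energy (k + 2) = (2 * real k + 3) * ln (2 * real k + 3)
        - (real k + 3) * ln (real k + 3) - (real k + 1) * ln (real k + 1)"
      using fekete_energy_Suc[of "k + 2"] by (simp add: algebra_simps)
    ultimately show ?case
      using Suc by simp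
  qed
  ultimately show ?thesis
    by (simp add: p_def)
qed

lemma min_energy_eq:
  assumes "n \<ge> 2"
  shows "min_energy n = fekete_energy n"
proof -
  obtain x where x: "fekete_points n x"
    using fekete_points_exist by blast
  obtain k where k: "n = k + 2"
    using le_Suc_ex[OF assms] by auto
  \<comment> \<open>The minimum is attained at \<open>x\<close>, so \<open>LEAST\<close> denotes
    this value.\<close>
  have "min_energy n = log_energy n x"
    using x unfolding min_energy_def fekete_points_def by (intro Least_equality) auto
  also have "\<dots> = - ln (distance_product (x ` {1..n}))"
    using x by (intro log_energy_eq) (simp add: fekete_points_def configurations_def)
  also have "\<dots> = fekete_energy n"
    using distance_product_fekete_set[OF fekete_set_image(1)[OF x], of k] fekete_set_image(2)[OF x] k
      ln_fekete_product[of k] by simp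
  finally show ?thesis .
qed

theorem theorem1:
  shows "(\<forall>n\<ge>2.
            (\<exists>x. fekete_points n x) \<and>
            min_energy n =
              - real n * (real n - 1) * ln 2 - 3 * (real n - 1) * ln (real n - 1) - real n * ln (real n)
              - 4 * (\<Sum>j=1..n-2. real j * ln (real j)) + (\<Sum>j=1..2*n-2. real j * ln (real j)))
       \<and> (\<lambda>n. min_energy n -
              (ln 2 * (real n)^2 - real n * ln (real n) - 2 * ln 2 * real n - 1/4 * ln (real n)))
           \<in> O(\<lambda>_. 1)"
proof (intro conjI allI impI)
  fix n :: nat assume "n \<ge> 2"
  then show "\<exists>x. fekete_points n x" "min_energy n =
      - real n * (real n - 1) * ln 2 - 3 * (real n - 1) * ln (real n - 1) - real n * ln (real n)
      - 4 * (\<Sum>j=1..n-2. real j * ln (real j)) + (\<Sum>j=1..2*n-2. real j * ln (real j))"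
    using fekete_points_exist min_energy_eq fekete_energy_def by auto
next
  have "eventually (\<lambda>n. fekete_energy n - (ln 2 * (real n)^2 - real n * ln (real n) - 2 * ln 2 * real n - 1/4 * ln (real n))
    = min_energy n - (ln 2 * (real n)^2 - real n * ln (real n) - 2 * ln 2 * real n - 1/4 * ln (real n))) at_top"
    using eventually_ge_at_top[of 2] by eventually_elim (simp add: min_energy_eq)
  from landau_o.big.in_cong[OF this] fekete_energy_asymp
  show "(\<lambda>n. min_energy n - (ln 2 * (real n)^2 - real n * ln (real n) - 2 * ln 2 * real n - 1/4 * ln (real n)))
           \<in> O(\<lambda>_. 1)"
    by blast
qed

end
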